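(* For all formulas $A$ and $B$, if $\mathsf{GL} \vdash A \rightarrow B$, then there is a formula $C$ such that $w(C) \subseteq w(A) \cap w(B)$ and \[\mathsf{GL} \vdash A \rightarrow C, \qquad \mathsf{GL} \vdash C \rightarrow B.\]
   Context: Formulas are built by $A ::= P \mid \overline{P} \mid \top \mid \bot \mid (A \wedge A) \mid (A \vee A) \mid \Box A \mid \Diamond A$, where $P$ ranges over atoms and $\overline{P}$ is the (primitive) complement of $P$. The negation $\overline{A}$ of a formula is defined inductively: $\overline{(P)} := \overline{P}$, $\overline{\overline{P}} := P$, $\overline{\top} := \bot$, $\overline{\bot} := \top$, $\overline{(A \wedge B)} := (\overline{A} \vee \overline{B})$, $\overline{(A \vee B)} := (\overline{A} \wedge \overline{B})$, $\overline{\Box A} := \Diamond \overline{A}$, $\overline{\Diamond A} := \Box \overline{A}$. Put $A \rightarrow B := \overline{A} \vee B$. $\mathsf{GL}$ (Gödel-Löb logic) is the Hilbert-style system with axioms: (i) Boolean tautologies; (ii) $\Box(A\rightarrow B)\rightarrow(\Box A\rightarrow\Box B)$; (iii) $\Box(\Box A\rightarrow A)\rightarrow\Box A$; and rules: modus ponens, and from $A$ infer $\Box A$. $\mathsf{GL}\vdash A$ means that $A$ is derivable in this system. Atoms $P$ and their complements $\overline{P}$ are called literals (as literals, $P$ and $\overline{P}$ are distinct, and an occurrence of $\overline{P}$ is not an occurrence of $P$). For a formula $A$, $u(A)$ is the set of literals $L$ that occur in $A$ outside the scope of all modal operators. For each literal $L$ there is a new symbol $L^\circ$ (i.e. $P^\circ$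 and $\overline{P}^\circ$), called a marked literal. $v(A)$ is the set of marked literals $L^\circ$ such that there is an occurrence of $L$ in $A$ within the scope of a modal operator ($\Box$ or $\Diamond$). Put $w(A) = u(A)\cup v(A)$. *)

theory Defs
  imports Main
begin

text \<open>Modal formulas in negation normal form over an arbitrary type of atoms.
  \<open>CoAtom P\<close> is the primitive complement of the atom \<open>P\<close>.\<close>

datatype 'p fm =
    Atom 'p
  | CoAtom 'p
  | Tru
  | Fls
  | And "'p fm" "'p fm"
  | Or "'p fm" "'p fm"
  | Box "'p fm"
  | Dia "'p fm"

primrec neg :: "'p fm \<Rightarrow> 'p fm" where
  "neg (Atom P) = CoAtom P"
| "neg (CoAtom P) = Atom P"
| "neg Tru = Fls"
| "neg Fls = Tru"
| "neg (And A B) = Or (neg A) (neg B)"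
| "neg (Or A B) = And (neg A) (neg B)"
| "neg (Box A) = Dia (neg A)"
| "neg (Dia A) = Box (neg A)"

definition Imp :: "'p fm \<Rightarrow> 'p fm \<Rightarrow> 'p fm" where
  "Imp A B = Or (neg A) B"

text \<open>Boolean truth of a modal formula: atoms and boxed formulas are evaluated by arbitrary
  assignments \<open>e\<close> and \<open>b\<close>. Since \<open>Dia A\<close> is the negation of \<open>Box (neg A)\<close>, it gets the opposite
  truth value of that formula and is not independent of it; so \<open>Imp (Box A) (Box A)\<close>, which is
  \<open>Or (Dia (neg A)) (Box A)\<close>, is a tautology.\<close>

primrec btrue :: "('p \<Rightarrow> bool) \<Rightarrow> ('p fm \<Rightarrow> bool) \<Rightarrow> 'p fm \<Rightarrow> bool" where
  "btrue e b (Atom P) \<longleftrightarrow> e P"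
| "btrue e b (CoAtom P) \<longleftrightarrow> \<not> e P"
| "btrue e b Tru \<longleftrightarrow> True"
| "btrue e b Fls \<longleftrightarrow> False"
| "btrue e b (And A B) \<longleftrightarrow> btrue e b A \<and> btrue e b B"
| "btrue e b (Or A B) \<longleftrightarrow> btrue e b A \<or> btrue e b B"
| "btrue e b (Box A) \<longleftrightarrow> b A"
| "btrue e b (Dia A) \<longleftrightarrow> \<not> b (neg A)"

definition boolean_tautology :: "'p fm \<Rightarrow> bool" where
  "boolean_tautology A \<longleftrightarrow> (\<forall>e b. btrue e b A)"

lemma neg_neg [simp]: "neg (neg A) = A"
  by (induction A) simp_all

lemma btrue_neg [simp]: "btrue e b (neg A) \<longleftrightarrow> \<not> btrue e b A"
  by (induction A) simp_all

inductive GL :: "'p fm \<Rightarrow> bool" where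
  Taut: "boolean_tautology A \<Longrightarrow> GL A"
| Distr: "GL (Imp (Box (Imp A B)) (Imp (Box A) (Box B)))"
| Loeb: "GL (Imp (Box (Imp (Box A) A)) (Box A))"
| MP: "GL (Imp A B) \<Longrightarrow> GL A \<Longrightarrow> GL B"
| Nec: "GL A \<Longrightarrow> GL (Box A)"

datatype 'p literal = Pos 'p | Neg 'p

primrec lits :: "'p fm \<Rightarrow> 'p literal set" where
  "lits (Atom P) = {Pos P}"
| "lits (CoAtom P) = {Neg P}"
| "lits Tru = {}"
| "lits Fls = {}"
| "lits (And A B) = lits A \<union> lits B"
| "lits (Or A B) = lits A \<union> lits B"
| "lits (Box A) = lits A"
| "lits (Dia A) = lits A"

text \<open>\<open>Plain L\<close> is the literal \<open>L\<close> itself and \<open>Marked L\<close> is the new symbol \<open>L\<^sup>\<circ>\<close>.\<close>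

datatype 'p sym = Plain "'p literal" | Marked "'p literal"

primrec u :: "'p fm \<Rightarrow> 'p sym set" where
  "u (Atom P) = {Plain (Pos P)}"
| "u (CoAtom P) = {Plain (Neg P)}"
| "u Tru = {}"
| "u Fls = {}"
| "u (And A B) = u A \<union> u B"
| "u (Or A B) = u A \<union> u B"
| "u (Box A) = {}"
| "u (Dia A) = {}"

primrec v :: "'p fm \<Rightarrow> 'p sym set" where
  "v (Atom P) = {}"
| "v (CoAtom P) = {}"
| "v Tru = {}"
| "v Fls = {}"
| "v (And A B) = v A \<union> v B"
| "v (Or A B) = v A \<union> v B"
| "v (Box A) = Marked ` lits A"
| "v (Dia A) = Marked ` lits A"

definition w :: "'p fm \<Rightarrow> 'p sym set" where
  "w A = u A \<union> v A"

end

(* If A and B have no interpolant, pick maximal consistent sets x containing A and y containing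
   neg B such that every formula of the common vocabulary lying in x lies in y.  Given Dia D in x,
   Loeb's axiom yields a successor x' with D and Box (neg D) in it, and some successor y' of y again
   makes (x', y') such a pair; the situation with Dia D in y is dual.  Along each of these steps one
   of the finitely many relevant formulas Dia D is lost for good, so these pairs form a transitive
   conversely well-founded Kripke model.  Its valuation can satisfy the literals required by x and
   by y simultaneously precisely because no shared literal separates them.  Hence A and neg B hold
   at the root, which contradicts the soundness of GL. *)

theory Submission
  imports Defs
begin

section \<open>Kripke soundness\<close>

primrec sat :: "('w \<Rightarrow> 'w \<Rightarrow> bool) \<Rightarrow> ('w \<Rightarrow> 'p \<Rightarrow> bool) \<Rightarrow> 'w \<Rightarrow> 'p fm \<Rightarrow> bool" where
  "sat R V s (Atom P) \<longleftrightarrow> V s P"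
| "sat R V s (CoAtom P) \<longleftrightarrow> \<not> V s P"
| "sat R V s Tru \<longleftrightarrow> True"
| "sat R V s Fls \<longleftrightarrow> False"
| "sat R V s (And A B) \<longleftrightarrow> sat R V s A \<and> sat R V s B"
| "sat R V s (Or A B) \<longleftrightarrow> sat R V s A \<or> sat R V s B"
| "sat R V s (Box A) \<longleftrightarrow> (\<forall>t. R s t \<longrightarrow> sat R V t A)"
| "sat R V s (Dia A) \<longleftrightarrow> (\<exists>t. R s t \<and> sat R V t A)"

lemma sat_neg [simp]: "sat R V s (neg A) \<longleftrightarrow> \<not> sat R V s A"
  by (induction A arbitrary: s) simp_all

lemma sat_Imp [simp]: "sat R V s (Imp A B) \<longleftrightarrow> (sat R V s A \<longrightarrow> sat R V s B)"
  by (simp add: Imp_def)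

text \<open>Each world induces a Boolean assignment, with boxes valued by their truth there; this is
  what makes tautologies hold at every world.\<close>

lemma sat_iff_btrue: "sat R V s A \<longleftrightarrow> btrue (V s) (\<lambda>B. sat R V s (Box B)) A"
  by (induction A) simp_all

lemma GL_sound:
  assumes "GL A" and trans: "transp R" and wf: "wfP R\<inverse>\<inverse>"
  shows "sat R V s A"
  using assms(1)
proof (induction arbitrary: s rule: GL.induct)
  case (Taut A)
  then show ?case
    by (metis boolean_tautology_def sat_iff_btrue)
next
  case (Loeb A)
  show ?case
  proof (simp, intro impI allI)
    fix t
    assume step: "\<forall>t. R s t \<longrightarrow> (\<forall>r. R t r \<longrightarrow> sat R V r A) \<longrightarrow> sat R V t A" and "R s t"
    \<comment> \<open>Induction from the successors of \<open>t\<close>: by transitivity they are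
      successors of \<open>s\<close> too, hence satisfy \<open>A\<close>, and \<open>step\<close>
      then yields \<open>A\<close> at \<open>t\<close>.\<close>
    from wf \<open>R s t\<close> show "sat R V t A"
    proof (induction t rule: wfp_induct_rule)
      case (less t)
      then show ?case
        using step transpD[OF trans] by blast
    qed
  qed
qed auto

section \<open>Propositional reasoning in GL\<close>

lemma btrue_Imp [simp]: "btrue e b (Imp A B) \<longleftrightarrow> (btrue e b A \<longrightarrow> btrue e b B)"
  by (simp add: Imp_def)

lemma GL_conseq:
  assumes "GL A" and "\<And>e b. btrue e b A \<Longrightarrow> btrue e b B"
  shows "GL B"
  by (rule GL.MP[OF GL.Taut assms(1)]) (simp add: boolean_tautology_def assms(2))

lemma GL_conseq2:
  assumes "GL A" "GL B" and "\<And>e b. btrue e b A \<Longrightarrow> btrue e b B \<Longrightarrow> btrue e b C"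
  shows "GL C"
proof -
  have "GL (Imp A (Imp B C))"
    using assms(3) by (intro GL.Taut) (simp add: boolean_tautology_def)
  then show ?thesis
    using assms(1,2) GL.MP by blast
qed

lemma GL_Box_mono: "GL (Imp A B) \<Longrightarrow> GL (Imp (Box A) (Box B))"
  using GL.MP[OF GL.Distr GL.Nec] .

text \<open>This is Loeb's axiom for \<open>And A (Box A)\<close>: given \<open>A\<close>, the box
  of that conjunction already implies the conjunction.\<close>

lemma GL_trans: "GL (Imp (Box A) (Box (Box A)))"
proof -
  let ?D = "And A (Box A)"
  have fst: "GL (Imp (Box ?D) (Box A))" and snd: "GL (Imp (Box ?D) (Box (Box A)))"
    by (rule GL_Box_mono, rule GL.Taut, simp add: boolean_tautology_def)+
  have "GL (Imp A (Imp (Box ?D) ?D))"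
    using fst by (rule GL_conseq) auto
  then have "GL (Imp (Box A) (Box (Imp (Box ?D) ?D)))"
    by (rule GL_Box_mono)
  then have "GL (Imp (Box A) (Box ?D))"
    using GL.Loeb[of ?D] by (rule GL_conseq2) auto
  then show ?thesis
    using snd by (rule GL_conseq2) auto
qed

primrec conjs :: "'p fm list \<Rightarrow> 'p fm" where
  "conjs [] = Tru"
| "conjs (A # As) = And A (conjs As)"

lemma btrue_conjs [simp]: "btrue e b (conjs As) \<longleftrightarrow> (\<forall>A\<in>set As. btrue e b A)"
  by (induction As) auto

section \<open>Maximal consistent sets\<close>

definition consistent :: "'p fm set \<Rightarrow> bool" where
  "consistent X \<longleftrightarrow> (\<forall>As. set As \<subseteq> X \<longrightarrow> \<not> GL (neg (conjs As)))"

definition mcs :: "'p fm set \<Rightarrow> bool" where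
  "mcs X \<longleftrightarrow> consistent X \<and> (\<forall>A. A \<in> X \<or> neg A \<in> X)"

text \<open>Resolution on \<open>A\<close>: the two refutations, with \<open>A\<close> and
  \<open>neg A\<close> deleted respectively, join to a refutation from \<open>X\<close>.\<close>

lemma consistent_insert:
  assumes "consistent X"
  shows "consistent (insert A X) \<or> consistent (insert (neg A) X)"
proof (rule ccontr)
  assume "\<not> ?thesis"
  then have "\<not> consistent (insert A X)" "\<not> consistent (insert (neg A) X)"
    by simp_all
  then obtain Bs Cs where Bs: "set Bs \<subseteq> insert A X" "GL (neg (conjs Bs))"
    and Cs: "set Cs \<subseteq> insert (neg A) X" "GL (neg (conjs Cs))"
    by (auto simp: consistent_def)
  let ?Ds = "removeAll A Bs @ removeAll (neg A) Cs"
  have "GL (neg (conjs ?Ds))"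
    using Bs(2) Cs(2)
  proof (rule GL_conseq2)
    fix e b
    assume "btrue e b (neg (conjs Bs))" "btrue e b (neg (conjs Cs))"
    then obtain B C where "B \<in> set Bs" "\<not> btrue e b B" "C \<in> set Cs" "\<not> btrue e b C"
      by auto
    moreover from this have "B \<noteq> A \<or> C \<noteq> neg A"
      by auto
    ultimately show "btrue e b (neg (conjs ?Ds))"
      unfolding btrue_neg btrue_conjs set_append set_removeAll by blast
  qed
  moreover have "set ?Ds \<subseteq> X"
    using Bs(1) Cs(1) by auto
  ultimately show False
    using assms unfolding consistent_def by blast
qed

lemma Lindenbaum:
  assumes "consistent X"
  obtains Y where "X \<subseteq> Y" "mcs Y"
proof -
  let ?S = "{Y. X \<subseteq> Y \<and> consistent Y}"
  have "\<exists>M\<in>?S. \<forall>Y\<in>?S. M \<subseteq> Y \<longrightarrow> Y = M"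
  proof (rule subset_Zorn_nonempty)
    show "?S \<noteq> {}"
      using assms by blast
  next
    fix \<C>
    assume "\<C> \<noteq> {}" and chain: "subset.chain ?S \<C>"
    have "consistent (\<Union>\<C>)"
      unfolding consistent_def
    proof (intro allI impI)
      fix As
      assume "set As \<subseteq> \<Union>\<C>"
      \<comment> \<open>A finite part of the union of a chain lies in a single member of the
        chain.\<close>
      then obtain Y where "Y \<in> \<C>" "set As \<subseteq> Y"
        using finite_subset_Union_chain[OF _ _ \<open>\<C> \<noteq> {}\<close> chain] by blast
      then show "\<not> GL (neg (conjs As))"
        using chain unfolding consistent_def subset_chain_def by blast
    qed
    then show "\<Union>\<C> \<in> ?S"
      using \<open>\<C> \<noteq> {}\<close> chain unfolding subset_chain_def by blast
  qed
  then obtain M where M: "X \<subseteq> M" "consistent M"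
    and max: "\<And>Y. M \<subseteq> Y \<Longrightarrow> consistent Y \<Longrightarrow> Y = M"
    by (smt (verit) mem_Collect_eq subset_trans)
  have "A \<in> M \<or> neg A \<in> M" for A
    using consistent_insert[OF M(2), of A] max by (metis insertI1 subset_insertI)
  then show thesis
    using that M unfolding mcs_def by blast
qed

lemma mcs_closed:
  assumes "mcs X" "set As \<subseteq> X" "GL (Imp (conjs As) B)"
  shows "B \<in> X"
proof (rule ccontr)
  assume "B \<notin> X"
  then have "set (neg B # As) \<subseteq> X"
    using assms(1,2) unfolding mcs_def by auto
  moreover have "GL (neg (conjs (neg B # As)))"
    using assms(3) by (rule GL_conseq) auto
  ultimately show False
    using assms(1) unfolding mcs_def consistent_def by blast
qed

lemma mcs_GL:
  assumes "mcs X" "GL A"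
  shows "A \<in> X"
proof (rule mcs_closed[OF assms(1), of "[]"])
  show "GL (Imp (conjs []) A)"
    using assms(2) by (rule GL_conseq) simp
qed simp

lemma mcs_neg:
  assumes "mcs X"
  shows "neg A \<in> X \<longleftrightarrow> A \<notin> X"
proof -
  have "GL (neg (conjs [A, neg A]))"
    by (rule GL.Taut) (simp add: boolean_tautology_def)
  then have "\<not> set [A, neg A] \<subseteq> X"
    using assms unfolding mcs_def consistent_def by blast
  then show ?thesis
    using assms unfolding mcs_def by auto
qed

lemma mcs_And:
  assumes X: "mcs X"
  shows "And A B \<in> X \<longleftrightarrow> A \<in> X \<and> B \<in> X"
proof -
  have "GL (Imp (conjs [And A B]) A)" and "GL (Imp (conjs [And A B]) B)"
    and intro: "GL (Imp (conjs [A, B]) (And A B))"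
    by (rule GL.Taut, simp add: boolean_tautology_def)+
  then have "A \<in> X \<and> B \<in> X" if "And A B \<in> X"
    using that mcs_closed[OF X, of "[And A B]"] by simp
  moreover have "And A B \<in> X" if "A \<in> X" "B \<in> X"
    using that mcs_closed[OF X _ intro] by simp
  ultimately show ?thesis
    by blast
qed

lemma mcs_Or: "mcs X \<Longrightarrow> Or A B \<in> X \<longleftrightarrow> A \<in> X \<or> B \<in> X"
  using mcs_And[of X "neg A" "neg B"] mcs_neg[of X "Or A B"] mcs_neg[of X A] mcs_neg[of X B]
  by auto

lemma mcs_Imp: "mcs X \<Longrightarrow> Imp A B \<in> X \<longleftrightarrow> (A \<in> X \<longrightarrow> B \<in> X)"
  by (simp add: Imp_def mcs_Or mcs_neg)

lemma mcs_Dia: "mcs X \<Longrightarrow> Dia A \<in> X \<longleftrightarrow> Box (neg A) \<notin> X"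
  using mcs_neg[of X "Box (neg A)"] by simp

lemma mcs_CoAtom: "mcs X \<Longrightarrow> CoAtom P \<in> X \<longleftrightarrow> Atom P \<notin> X"
  using mcs_neg[of X "Atom P"] by simp

lemma mcs_Tru: "mcs X \<Longrightarrow> Tru \<in> X"
  by (rule mcs_GL) (auto intro: GL.Taut simp: boolean_tautology_def)

lemma mcs_Fls: "mcs X \<Longrightarrow> Fls \<notin> X"
  using mcs_neg[of X Tru] mcs_Tru[of X] by simp

lemma mcs_conjs: "mcs X \<Longrightarrow> conjs As \<in> X \<longleftrightarrow> set As \<subseteq> X"
  by (induction As) (auto simp: mcs_And mcs_Tru)

section \<open>The canonical relation\<close>

text \<open>Passing on \<open>Box A\<close> as well as \<open>A\<close> makes the relation
  transitive by definition.\<close>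

definition can :: "'p fm set \<Rightarrow> 'p fm set \<Rightarrow> bool" where
  "can X Y \<longleftrightarrow> (\<forall>A. Box A \<in> X \<longrightarrow> A \<in> Y \<and> Box A \<in> Y)"

lemma can_trans: "can X Y \<Longrightarrow> can Y Z \<Longrightarrow> can X Z"
  unfolding can_def by blast

text \<open>Contraposition on boxes. By the second part no diamond is ever gained along
  \<open>can\<close>, so the counts in \<open>pending\<close> cannot grow.\<close>

lemma can_Dia:
  assumes "mcs X" "mcs Y" "can X Y"
  shows "A \<in> Y \<Longrightarrow> Dia A \<in> X" "Dia A \<in> Y \<Longrightarrow> Dia A \<in> X"
  using assms unfolding can_def by (metis mcs_Dia mcs_neg)+

lemma mcs_Box_mono:
  assumes "mcs X" "Box A \<in> X" "GL (Imp A B)"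
  shows "Box B \<in> X"
  using mcs_GL[OF assms(1) GL_Box_mono[OF assms(3)]] assms(1,2) by (simp add: mcs_Imp)

lemma mcs_Box_conj:
  assumes "mcs X" "set As \<subseteq> {A. Box A \<in> X}" "GL (Imp (conjs As) B)"
  shows "Box B \<in> X"
  using assms(2,3)
proof (induction As arbitrary: B)
  case Nil
  have "GL B"
    using Nil.prems(2) by (rule GL_conseq) simp
  then show ?case
    using assms(1) GL.Nec mcs_GL by blast
next
  case (Cons A As)
  have "GL (Imp (conjs As) (Imp A B))"
    using Cons.prems(2) by (rule GL_conseq) auto
  then have "Box (Imp A B) \<in> X"
    using Cons.prems(1) by (intro Cons.IH) auto
  then show ?case
    using mcs_GL[OF assms(1) GL.Distr, of A B] Cons.prems(1) assms(1) by (auto simp: mcs_Imp)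
qed

text \<open>All successors come from here; \<open>S\<close> collects the extra demands on them. A
  refutation of \<open>S\<close> together with the boxed contents of \<open>X\<close> would put an
  excluded box into \<open>X\<close>.\<close>

lemma can_extension:
  assumes X: "mcs X" and S: "\<And>Cs. set Cs \<subseteq> S \<Longrightarrow> Box (neg (conjs Cs)) \<notin> X"
  obtains Y where "mcs Y" "can X Y" "S \<subseteq> Y"
proof -
  let ?T = "{A. Box A \<in> X}"
  have "consistent (?T \<union> S)"
    unfolding consistent_def
  proof (intro allI impI notI)
    fix As
    assume As: "set As \<subseteq> ?T \<union> S" "GL (neg (conjs As))"
    let ?Bs = "filter (\<lambda>A. A \<in> ?T) As" and ?Cs = "filter (\<lambda>A. A \<notin> ?T) As"
    have "GL (Imp (conjs ?Bs) (neg (conjs ?Cs)))"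
      using As(2) by (rule GL_conseq) auto
    then have "Box (neg (conjs ?Cs)) \<in> X"
      by (rule mcs_Box_conj[OF X, rotated]) auto
    then show False
      using S[of ?Cs] As(1) by auto
  qed
  then obtain Y where Y: "?T \<union> S \<subseteq> Y" "mcs Y"
    using Lindenbaum by blast
  \<comment> \<open>Boxes in \<open>X\<close> are themselves boxed contents of \<open>X\<close>, so
    they pass to \<open>Y\<close> as \<open>can\<close> demands.\<close>
  have "Box (Box A) \<in> X" if "Box A \<in> X" for A
    using mcs_GL[OF X GL_trans, of A] that X by (simp add: mcs_Imp)
  then show thesis
    using that Y unfolding can_def by blast
qed

text \<open>Loeb's axiom in dual form: if \<open>D\<close> is possible, then \<open>D\<close>
  together with \<open>Box (neg D)\<close> is possible.\<close>

lemma can_witness: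
  assumes X: "mcs X" and D: "Dia D \<in> X"
  obtains Y where "mcs Y" "can X Y" "D \<in> Y" "Dia D \<notin> Y"
proof -
  have "Box (neg (conjs Cs)) \<notin> X" if "set Cs \<subseteq> {D, Box (neg D)}" for Cs
  proof
    assume "Box (neg (conjs Cs)) \<in> X"
    moreover have "GL (Imp (neg (conjs Cs)) (Imp (Box (neg D)) (neg D)))"
      using that by (intro GL.Taut) (auto simp: boolean_tautology_def)
    ultimately have "Box (Imp (Box (neg D)) (neg D)) \<in> X"
      using X mcs_Box_mono by blast
    then have "Box (neg D) \<in> X"
      using mcs_GL[OF X GL.Loeb, of "neg D"] X by (simp add: mcs_Imp)
    then show False
      using D X by (simp add: mcs_Dia)
  qed
  then obtain Y where "mcs Y" "can X Y" "{D, Box (neg D)} \<subseteq> Y"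
    using can_extension[OF X] by blast
  then show thesis
    using that by (simp add: mcs_Dia)
qed

text \<open>A finite conjunction of \<open>K'\<close> formulas in \<open>X'\<close> is possible at
  \<open>X\<close>; its diamond satisfies \<open>K\<close> and so transfers to \<open>Y\<close>. The
  predicates are abstract because the step is used both from left to right and from right to
  left.\<close>

lemma can_forth:
  assumes mcs: "mcs X" "mcs X'" "mcs Y" and "can X X'"
    and le: "\<And>C. K C \<Longrightarrow> C \<in> X \<Longrightarrow> C \<in> Y"
    and Dia: "\<And>C. K' C \<Longrightarrow> K (Dia C)"
    and K': "K' Tru" "\<And>B C. K' B \<Longrightarrow> K' C \<Longrightarrow> K' (And B C)"
  obtains Y' where "mcs Y'" "can Y Y'" "\<And>C. K' C \<Longrightarrow> C \<in> X' \<Longrightarrow> C \<in> Y'"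
proof -
  have "Box (neg (conjs Cs)) \<notin> Y" if "set Cs \<subseteq> {C \<in> X'. K' C}" for Cs
  proof -
    have "K' (conjs Cs)"
      using that by (induction Cs) (auto intro: K')
    moreover have "conjs Cs \<in> X'"
      using that mcs(2) by (auto simp: mcs_conjs)
    ultimately have "Dia (conjs Cs) \<in> Y"
      using le Dia can_Dia(1)[OF mcs(1,2) \<open>can X X'\<close>] by blast
    then show ?thesis
      using mcs(3) by (simp add: mcs_Dia)
  qed
  then obtain Y' where "mcs Y'" "can Y Y'" "{C \<in> X'. K' C} \<subseteq> Y'"
    using can_extension[OF mcs(3)] by blast
  then show thesis
    using that by blast
qed

section \<open>Vocabularies\<close>

lemma w_simps [simp]:
  "w (Atom P) = {Plain (Pos P)}" "w (CoAtom P) = {Plain (Neg P)}" "w Tru = {}" "w Fls = {}"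
  "w (And A B) = w A \<union> w B" "w (Or A B) = w A \<union> w B"
  "w (Box A) = Marked ` lits A" "w (Dia A) = Marked ` lits A"
  by (auto simp: w_def)

text \<open>The vocabulary one modality deeper: a literal marked in \<open>Z\<close> may now occur
  at any depth, an unmarked symbol of \<open>Z\<close> permits nothing.\<close>

definition inner :: "'p sym set \<Rightarrow> 'p sym set" where
  "inner Z = Plain ` {L. Marked L \<in> Z} \<union> Marked ` {L. Marked L \<in> Z}"

lemma inner_idem [simp]: "inner (inner Z) = inner Z"
  unfolding inner_def by auto

lemma inner_Int: "inner (Y \<inter> Z) = inner Y \<inter> inner Z"
  unfolding inner_def by auto

text \<open>The right-hand side is the vocabulary condition on \<open>Box A\<close> and on
  \<open>Dia A\<close>, so \<open>inner Z\<close> is the exact vocabulary for formulas under a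
  modality.\<close>

lemma w_subset_inner_iff: "w A \<subseteq> inner Z \<longleftrightarrow> Marked ` lits A \<subseteq> Z"
proof (induction A)
  case (Box A)
  then show ?case by (auto simp: inner_def)
next
  case (Dia A)
  then show ?case by (auto simp: inner_def)
qed (auto simp: inner_def)

text \<open>These are the diamonds that need witnesses in the model; their finiteness makes counting
  possible.\<close>

primrec dias :: "'p fm \<Rightarrow> 'p fm set" where
  "dias (Atom P) = {}"
| "dias (CoAtom P) = {}"
| "dias Tru = {}"
| "dias Fls = {}"
| "dias (And A B) = dias A \<union> dias B"
| "dias (Or A B) = dias A \<union> dias B"
| "dias (Box A) = dias A"
| "dias (Dia A) = insert A (dias A)"

lemma finite_dias: "finite (dias A)"
  by (induction A) simp_all

section \<open>The model of inseparable pairs\<close>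

type_synonym 'p world = "('p sym set \<times> 'p fm set) \<times> ('p sym set \<times> 'p fm set)"

text \<open>\<open>Z\<close> is the vocabulary of the right-hand formula, whereas \<open>y\<close>
  holds its negation; so membership of common formulas passes from \<open>x\<close> to
  \<open>y\<close>.\<close>

fun inseparable :: "'p world \<Rightarrow> bool" where
  "inseparable ((Y, x), (Z, y)) \<longleftrightarrow>
    mcs x \<and> mcs y \<and> (\<forall>C. w C \<subseteq> Y \<inter> Z \<longrightarrow> C \<in> x \<longrightarrow> C \<in> y)"

fun pending :: "'p fm set \<Rightarrow> 'p world \<Rightarrow> nat" where
  "pending F ((Y, x), (Z, y)) = card {D \<in> F. Dia D \<in> x} + card {D \<in> F. Dia D \<in> y}"

text \<open>The decrease of \<open>pending\<close> is built in, which gives converse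
  well-foundedness at once; transitivity holds since \<open>inner\<close> is idempotent. The work
  lies in finding successors.\<close>

fun acc :: "'p fm set \<Rightarrow> 'p world \<Rightarrow> 'p world \<Rightarrow> bool" where
  "acc F ((Y, x), (Z, y)) ((Y', x'), (Z', y')) \<longleftrightarrow>
    inseparable ((Y', x'), (Z', y')) \<and> Y' = inner Y \<and> Z' = inner Z \<and> can x x' \<and> can y y' \<and>
    pending F ((Y', x'), (Z', y')) < pending F ((Y, x), (Z, y))"

text \<open>\<open>Plain (Neg P) \<in> Z\<close> says that \<open>Pos P\<close> is in the vocabulary of the negated
  right-hand formula, for which \<open>y\<close> is responsible.\<close>

fun val :: "'p world \<Rightarrow> 'p \<Rightarrow> bool" where
  "val ((Y, x), (Z, y)) P \<longleftrightarrow>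
    Plain (Pos P) \<in> Y \<and> Atom P \<in> x \<or> Plain (Neg P) \<in> Z \<and> Atom P \<in> y"

lemma transp_acc: "transp (acc F)"
proof (rule transpI)
  fix r s t :: "'a world"
  assume "acc F r s" "acc F s t"
  then show "acc F r t"
    by (cases r; cases s; cases t) (auto elim: can_trans)
qed

lemma wfp_acc: "wfP (acc F)\<inverse>\<inverse>"
proof (rule wfp_if_convertible_to_nat)
  fix s t
  assume "(acc F)\<inverse>\<inverse> s t"
  then show "pending F s < pending F t"
    by (cases s; cases t) auto
qed

section \<open>Existence of successor pairs\<close>

lemma card_pending_le:
  assumes "finite F" "mcs x" "mcs x'" "can x x'"
  shows "card {D \<in> F. Dia D \<in> x'} \<le> card {D \<in> F. Dia D \<in> x}"
  using assms can_Dia(2) by (intro card_mono) auto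

lemma card_pending_less:
  assumes "finite F" "mcs x" "mcs x'" "can x x'" "D \<in> F" "Dia D \<in> x" "Dia D \<notin> x'"
  shows "card {D \<in> F. Dia D \<in> x'} < card {D \<in> F. Dia D \<in> x}"
  using assms can_Dia(2) by (intro psubset_card_mono) auto

text \<open>The witness for \<open>D\<close> loses \<open>Dia D\<close> on the left, and the right
  side follows by \<open>can_forth\<close> without gaining diamonds.\<close>

lemma acc_left:
  assumes "finite F" and insep: "inseparable ((Y, x), (Z, y))" and D: "D \<in> F" "Dia D \<in> x"
  obtains x' y' where "acc F ((Y, x), (Z, y)) ((inner Y, x'), (inner Z, y'))" "D \<in> x'"
proof -
  have xy: "mcs x" "mcs y" "\<And>C. w C \<subseteq> Y \<inter> Z \<Longrightarrow> C \<in> x \<Longrightarrow> C \<in> y"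
    using insep by auto
  obtain x' where x': "mcs x'" "can x x'" "D \<in> x'" "Dia D \<notin> x'"
    using can_witness[OF xy(1) D(2)] .
  obtain y' where y': "mcs y'" "can y y'"
      "\<And>C. w C \<subseteq> inner (Y \<inter> Z) \<Longrightarrow> C \<in> x' \<Longrightarrow> C \<in> y'"
    by (rule can_forth[of x x' y "\<lambda>C. w C \<subseteq> Y \<inter> Z" "\<lambda>C. w C \<subseteq> inner (Y \<inter> Z)"])
      (use xy x' in \<open>auto simp: w_subset_inner_iff\<close>)
  have "card {D \<in> F. Dia D \<in> x'} < card {D \<in> F. Dia D \<in> x}"
    "card {D \<in> F. Dia D \<in> y'} \<le> card {D \<in> F. Dia D \<in> y}"
    using card_pending_less[OF assms(1) xy(1) x'(1,2) D x'(4)]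
      card_pending_le[OF assms(1) xy(2) y'(1,2)] .
  then show thesis
    using x' y' by (intro that[of x' y']) (simp_all add: inner_Int)
qed

lemma acc_right:
  assumes "finite F" and insep: "inseparable ((Y, x), (Z, y))" and D: "D \<in> F" "Dia D \<in> y"
  obtains x' y' where "acc F ((Y, x), (Z, y)) ((inner Y, x'), (inner Z, y'))" "D \<in> y'"
proof -
  have xy: "mcs x" "mcs y" "\<And>C. w C \<subseteq> Y \<inter> Z \<Longrightarrow> C \<in> x \<Longrightarrow> C \<in> y"
    using insep by auto
  obtain y' where y': "mcs y'" "can y y'" "D \<in> y'" "Dia D \<notin> y'"
    using can_witness[OF xy(2) D(2)] .
  \<comment> \<open>Inseparability in contrapositive form: it transfers from \<open>y\<close> to
    \<open>x\<close> those formulas whose negation is in the common vocabulary.\<close>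
  have dual: "C \<in> x" if "w (neg C) \<subseteq> Y \<inter> Z" "C \<in> y" for C
    using xy(3)[OF that(1)] that(2) mcs_neg[OF xy(1)] mcs_neg[OF xy(2)] by blast
  obtain x' where x': "mcs x'" "can x x'"
      "\<And>C. w (neg C) \<subseteq> inner (Y \<inter> Z) \<Longrightarrow> C \<in> y' \<Longrightarrow> C \<in> x'"
    by (rule can_forth[of y y' x "\<lambda>C. w (neg C) \<subseteq> Y \<inter> Z" "\<lambda>C. w (neg C) \<subseteq> inner (Y \<inter> Z)"])
      (use xy y' dual in \<open>auto simp: w_subset_inner_iff\<close>)
  have "C \<in> y'" if "w C \<subseteq> inner (Y \<inter> Z)" "C \<in> x'" for C
  proof (rule ccontr)
    assume "C \<notin> y'"
    then have "neg C \<in> y'"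
      using y'(1) mcs_neg by blast
    then have "neg C \<in> x'"
      using that(1) by (intro x'(3)) simp_all
    then show False
      using that(2) x'(1) mcs_neg by blast
  qed
  moreover have "card {D \<in> F. Dia D \<in> x'} \<le> card {D \<in> F. Dia D \<in> x}"
    "card {D \<in> F. Dia D \<in> y'} < card {D \<in> F. Dia D \<in> y}"
    using card_pending_le[OF assms(1) xy(1) x'(1,2)]
      card_pending_less[OF assms(1) xy(2) y'(1,2) D y'(4)] .
  ultimately show thesis
    using x' y' by (intro that[of x' y']) (simp_all add: inner_Int)
qed

section \<open>Truth lemmas for the two components\<close>

text \<open>Only membership implies truth: vocabularies distinguish polarities, so the condition on
  \<open>A\<close> says nothing about \<open>neg A\<close>.\<close>

lemma truth_left:
  assumes "finite F" "inseparable ((Y, x), (Z, y))" "w A \<subseteq> Y" "dias A \<subseteq> F" "A \<in> x"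
  shows "sat (acc F) val ((Y, x), (Z, y)) A"
  using assms(2-)
proof (induction A arbitrary: Y x Z y)
  case (CoAtom P)
  \<comment> \<open>\<open>CoAtom P\<close> is then a common formula and transfers to
    \<open>y\<close>; this rules out the second disjunct of \<open>val\<close>, while
    \<open>x\<close> rules out the first.\<close>
  have "CoAtom P \<in> y" if "Plain (Neg P) \<in> Z"
    using CoAtom that by auto
  then have "Atom P \<notin> y" if "Plain (Neg P) \<in> Z"
    using CoAtom.prems(1) that mcs_CoAtom[of y P] by auto
  then show ?case
    using CoAtom by (auto simp: mcs_CoAtom)
next
  case (Box A)
  then have "w A \<subseteq> inner Y"
    by (simp add: w_subset_inner_iff)
  with Box show ?case
    by (auto simp: can_def)
next
  case (Dia A)
  then have "w A \<subseteq> inner Y"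
    by (simp add: w_subset_inner_iff)
  have "A \<in> F"
    using Dia.prems(3) by simp
  then obtain x' y' where acc: "acc F ((Y, x), (Z, y)) ((inner Y, x'), (inner Z, y'))"
    and "A \<in> x'"
    using acc_left[OF assms(1) Dia.prems(1) _ Dia.prems(4)] by blast
  have "sat (acc F) val ((inner Y, x'), (inner Z, y')) A"
  proof (rule Dia.IH)
    show "inseparable ((inner Y, x'), (inner Z, y'))"
      using acc by simp
  qed (use \<open>_ \<subseteq> inner _\<close> \<open>A \<in> x'\<close> Dia.prems(3) in simp_all)
  with acc show ?case
    unfolding sat.simps by (intro exI conjI)
qed (auto simp: mcs_And mcs_Or mcs_Fls)

lemma truth_right:
  assumes "finite F" "inseparable ((Y, x), (Z, y))" "w (neg A) \<subseteq> Z" "dias A \<subseteq> F" "A \<in> y"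
  shows "sat (acc F) val ((Y, x), (Z, y)) A"
  using assms(2-)
proof (induction A arbitrary: Y x Z y)
  case (CoAtom P)
  \<comment> \<open>Here \<open>Plain (Pos P)\<close> is in \<open>Z\<close> too, so
    \<open>Atom P\<close> would transfer from \<open>x\<close> to \<open>y\<close> and clash with
    \<open>CoAtom P\<close>.\<close>
  have "Atom P \<in> y" if "Plain (Pos P) \<in> Y" "Atom P \<in> x"
    using CoAtom that by auto
  then show ?case
    using CoAtom by (auto simp: mcs_CoAtom)
next
  case (Box A)
  then have "w (neg A) \<subseteq> inner Z"
    by (simp add: w_subset_inner_iff)
  with Box show ?case
    by (auto simp: can_def)
next
  case (Dia A)
  then have "w (neg A) \<subseteq> inner Z"
    by (simp add: w_subset_inner_iff)
  have "A \<in> F"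
    using Dia.prems(3) by simp
  then obtain x' y' where acc: "acc F ((Y, x), (Z, y)) ((inner Y, x'), (inner Z, y'))"
    and "A \<in> y'"
    using acc_right[OF assms(1) Dia.prems(1) _ Dia.prems(4)] by blast
  have "sat (acc F) val ((inner Y, x'), (inner Z, y')) A"
  proof (rule Dia.IH)
    show "inseparable ((inner Y, x'), (inner Z, y'))"
      using acc by simp
  qed (use \<open>_ \<subseteq> inner _\<close> \<open>A \<in> y'\<close> Dia.prems(3) in simp_all)
  with acc show ?case
    unfolding sat.simps by (intro exI conjI)
qed (auto simp: mcs_And mcs_Or mcs_Fls)

section \<open>The root pair and interpolation\<close>

text \<open>First \<open>y\<close> is built from \<open>neg B\<close> and all consequences of
  \<open>A\<close> in the common vocabulary, then \<open>x\<close> from \<open>A\<close> and what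
  \<open>y\<close> forces on it.\<close>

lemma inseparable_root:
  assumes none: "\<not> (\<exists>C. w C \<subseteq> w A \<inter> w B \<and> GL (Imp A C) \<and> GL (Imp C B))"
  obtains x y where "inseparable ((w A, x), (w B, y))" "A \<in> x" "neg B \<in> y"
proof -
  let ?Z = "w A \<inter> w B"
  \<comment> \<open>Otherwise finitely many of these consequences imply \<open>B\<close>, and their
    conjunction is an interpolant.\<close>
  have "consistent (insert (neg B) {C. w C \<subseteq> ?Z \<and> GL (Imp A C)})"
    unfolding consistent_def
  proof (intro allI impI notI)
    fix Cs
    assume Cs: "set Cs \<subseteq> insert (neg B) {C. w C \<subseteq> ?Z \<and> GL (Imp A C)}" "GL (neg (conjs Cs))"
    let ?Ds = "removeAll (neg B) Cs"
    have "set ?Ds \<subseteq> {C. w C \<subseteq> ?Z \<and> GL (Imp A C)}"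
      using Cs(1) by auto
    moreover have "w (conjs Ds) \<subseteq> ?Z \<and> GL (Imp A (conjs Ds))"
      if "set Ds \<subseteq> {C. w C \<subseteq> ?Z \<and> GL (Imp A C)}" for Ds
      using that
    proof (induction Ds)
      case Nil
      show ?case
        by (auto intro: GL.Taut simp: boolean_tautology_def)
    next
      case (Cons D Ds)
      then have "GL (Imp A D)" "GL (Imp A (conjs Ds))"
        by auto
      then have "GL (Imp A (conjs (D # Ds)))"
        by (rule GL_conseq2) auto
      then show ?case
        using Cons by auto
    qed
    moreover have "GL (Imp (conjs ?Ds) B)"
      using Cs(2)
    proof (rule GL_conseq)
      fix e b
      assume "btrue e b (neg (conjs Cs))"
      then obtain C where "C \<in> set Cs" "\<not> btrue e b C"
        by auto
      moreover have "C = neg B \<or> C \<in> set ?Ds"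
        using \<open>C \<in> set Cs\<close> by simp
      ultimately show "btrue e b (Imp (conjs ?Ds) B)"
        by auto
    qed
    ultimately show False
      using none by blast
  qed
  then obtain y where y: "insert (neg B) {C. w C \<subseteq> ?Z \<and> GL (Imp A C)} \<subseteq> y" "mcs y"
    using Lindenbaum by blast
  have "consistent (insert A {C. w (neg C) \<subseteq> ?Z \<and> C \<in> y})"
    unfolding consistent_def
  proof (intro allI impI notI)
    fix Cs
    assume Cs: "set Cs \<subseteq> insert A {C. w (neg C) \<subseteq> ?Z \<and> C \<in> y}" "GL (neg (conjs Cs))"
    let ?Ds = "removeAll A Cs"
    have Ds: "set ?Ds \<subseteq> {C. w (neg C) \<subseteq> ?Z \<and> C \<in> y}"
      using Cs(1) by auto
    have "w (neg (conjs Ds)) \<subseteq> ?Z" if "set Ds \<subseteq> {C. w (neg C) \<subseteq> ?Z \<and> C \<in> y}" for Ds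
      using that by (induction Ds) auto
    moreover have "GL (Imp A (neg (conjs ?Ds)))"
      using Cs(2) by (rule GL_conseq) auto
    \<comment> \<open>This negation is a consequence of \<open>A\<close> in the common vocabulary,
      and \<open>y\<close> contains all of those.\<close>
    ultimately have "neg (conjs ?Ds) \<in> y"
      using y(1) Ds by blast
    moreover have "conjs ?Ds \<in> y"
      using Ds y(2) mcs_conjs by blast
    ultimately show False
      using y(2) by (simp add: mcs_neg)
  qed
  then obtain x where x: "insert A {C. w (neg C) \<subseteq> ?Z \<and> C \<in> y} \<subseteq> x" "mcs x"
    using Lindenbaum by blast
  have "C \<in> y" if "w C \<subseteq> ?Z" "C \<in> x" for C
  proof (rule ccontr)
    assume "C \<notin> y"
    then have "neg C \<in> y"
      using y(2) mcs_neg by blast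
    then have "neg C \<in> x"
      using that(1) by (intro subsetD[OF x(1)]) simp
    then show False
      using x(2) that(2) by (simp add: mcs_neg)
  qed
  then show thesis
    using that x y by auto
qed

theorem theorem4p1:
  fixes A B :: "'p fm"
  assumes "GL (Imp A B)"
  shows "\<exists>C :: 'p fm. w C \<subseteq> w A \<inter> w B \<and> GL (Imp A C) \<and> GL (Imp C B)"
proof (rule ccontr)
  assume "\<not> ?thesis"
  then obtain x y where xy: "inseparable ((w A, x), (w B, y))" "A \<in> x" "neg B \<in> y"
    by (rule inseparable_root)
  \<comment> \<open>Witnesses are needed for the diamonds of \<open>A\<close> on the left and of
    \<open>neg B\<close> on the right.\<close>
  let ?F = "dias A \<union> dias (neg B)" and ?r = "((w A, x), (w B, y))"
  have "sat (acc ?F) val ?r A"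
    using xy by (intro truth_left) (auto simp: finite_dias)
  moreover have "sat (acc ?F) val ?r (neg B)"
    using xy by (intro truth_right) (auto simp: finite_dias)
  moreover have "sat (acc ?F) val ?r (Imp A B)"
    using assms transp_acc wfp_acc by (rule GL_sound)
  ultimately show False
    by simp
qed

end
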